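(* Let $R$ be a finite commutative ring with unity $e$ whose set of units $U(R)$ consists of $m$ distinct sets of mutual inverses $\{r_i,r_j\}$, each of order (cardinality) $1$ or $2$. Then $\gamma(\Gamma'(R))=m$, where $\Gamma'(R)$ is the unity product graph associated with $R$.
   Context: A set of mutual inverses is a set $\{r_i,r_j\}\subseteq U(R)$ with $r_i\cdot r_j=e$ (possibly $r_i=r_j$, in which case it has cardinality $1$); thus $m$ is the number of distinct sets $\{r,r^{-1}\}$ with $r\in U(R)$. The unity product graph $\Gamma'(R)$ is the simple graph with vertex set $U(R)$ in which two distinct vertices $r_i,r_j$ are adjacent if and only if $r_i\cdot r_j=e$. A dominating set of a graph $\Gamma$ is a set $D$ of vertices such that every vertex not in $D$ is adjacent to some vertex in $D$; the domination number $\gamma(\Gamma)$ is the minimum cardinality of a dominating set. *)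

theory Defs
  imports "HOL-Algebra.Ring" "HOL-Library.Disjoint_Sets" "Graph_Theory.Pair_Digraph"
begin

text \<open>As in the Graph_Theory library, a simple graph is a loop-free symmetric digraph
  (locale \<^locale>\<open>graph\<close>): an edge is a pair of opposite arcs.\<close>

definition dominating_set :: "('a, 'b) pre_digraph \<Rightarrow> 'a set \<Rightarrow> bool" where
  "dominating_set G D \<longleftrightarrow>
     D \<subseteq> verts G \<and> (\<forall>v \<in> verts G - D. \<exists>u \<in> D. dominates G v u)"

text \<open>Finiteness excludes infinite sets, whose \<^const>\<open>card\<close> is 0. The value is unspecified
  if the graph has no finite dominating set, which cannot happen for a finite graph.\<close>

definition domination_number :: "('a, 'b) pre_digraph \<Rightarrow> nat" where
  "domination_number G = (LEAST k. \<exists>D. dominating_set G D \<and> finite D \<and> card D = k)"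

definition mutual_inverse_sets :: "('a, 'b) ring_scheme \<Rightarrow> 'a set set" where
  "mutual_inverse_sets R =
     {{r, s} | r s. r \<in> Units R \<and> s \<in> Units R \<and> r \<otimes>\<^bsub>R\<^esub> s = \<one>\<^bsub>R\<^esub>}"

definition unity_product_graph :: "('a, 'b) ring_scheme \<Rightarrow> 'a pair_pre_digraph" where
  "unity_product_graph R =
     \<lparr>pverts = Units R,
      parcs = {(r, s). r \<in> Units R \<and> s \<in> Units R \<and> r \<noteq> s \<and> r \<otimes>\<^bsub>R\<^esub> s = \<one>\<^bsub>R\<^esub>}\<rparr>"

lemma pair_graph_unity_product_graph:
  assumes "cring R" "finite (carrier R)"
  shows "pair_graph (unity_product_graph R)"
proof -
  interpret cring R by fact
  let ?A = "{(r, s). r \<in> Units R \<and> s \<in> Units R \<and> r \<noteq> s \<and> r \<otimes>\<^bsub>R\<^esub> s = \<one>\<^bsub>R\<^esub>}"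
  have fin: "finite (Units R)"
    using assms(2) by (rule finite_subset[rotated]) auto
  have "?A \<subseteq> Units R \<times> Units R" by auto
  with fin have finA: "finite ?A" by (meson finite_SigmaI finite_subset)
  have symA: "(s, r) \<in> ?A" if "(r, s) \<in> ?A" for r s
    using that m_comm[of r s, OF Units_closed Units_closed] by auto
  interpret pair_pre_digraph "unity_product_graph R" .
  have ends: "arcs_ends (with_proj (unity_product_graph R)) = ?A"
    by (simp add: arcs_ends_def arc_to_ends_def unity_product_graph_def)
  show ?thesis
  proof
    show "symmetric (with_proj (unity_product_graph R))"
      unfolding symmetric_def ends by (rule symI) (rule symA)
  qed (use fin finA in \<open>auto simp: unity_product_graph_def\<close>)
qed

lemma mutual_inverse_sets_partition:
  assumes "cring R"
  shows "\<Union> (mutual_inverse_sets R) = Units R"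
    and "S \<in> mutual_inverse_sets R \<Longrightarrow> card S = 1 \<or> card S = 2"
    and "disjoint (mutual_inverse_sets R)"
proof -
  interpret cring R by fact
  show "\<Union> (mutual_inverse_sets R) = Units R"
  proof
    show "Units R \<subseteq> \<Union> (mutual_inverse_sets R)"
    proof
      fix r assume "r \<in> Units R"
      then have "{r, inv\<^bsub>R\<^esub> r} \<in> mutual_inverse_sets R"
        unfolding mutual_inverse_sets_def using Units_inv_Units Units_r_inv by blast
      then show "r \<in> \<Union> (mutual_inverse_sets R)" by blast
    qed
  qed (auto simp: mutual_inverse_sets_def)
  show "S \<in> mutual_inverse_sets R \<Longrightarrow> card S = 1 \<or> card S = 2"
    unfolding mutual_inverse_sets_def using card_2_iff by fastforce
  have eq: "S = {t, inv\<^bsub>R\<^esub> t}" if S: "S \<in> mutual_inverse_sets R" and t: "t \<in> S" for S t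
  proof -
    obtain r s where rs: "S = {r, s}" "r \<in> Units R" "s \<in> Units R" "r \<otimes>\<^bsub>R\<^esub> s = \<one>\<^bsub>R\<^esub>"
      using S unfolding mutual_inverse_sets_def by blast
    have "s \<otimes>\<^bsub>R\<^esub> r = \<one>\<^bsub>R\<^esub>"
      using rs by (simp add: m_comm Units_closed)
    with rs have "inv\<^bsub>R\<^esub> r = s" "inv\<^bsub>R\<^esub> s = r"
      by (auto intro: comm_inv_char Units_closed)
    with rs(1) t show ?thesis by auto
  qed
  show "disjoint (mutual_inverse_sets R)"
    unfolding disjoint_def
  proof (intro ballI impI)
    fix S T assume "S \<in> mutual_inverse_sets R" "T \<in> mutual_inverse_sets R" "S \<noteq> T"
    then show "S \<inter> T = {}" using eq[of S] eq[of T] by (metis disjoint_iff)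
  qed
qed

end

theory Submission
  imports Defs
begin

text \<open>Every unit \<open>r\<close> has at most one neighbour, namely \<open>r\<^sup>-\<^sup>1\<close>, so the graph is a
  disjoint union of isolated vertices and single edges, whose vertex sets are exactly the sets of
  mutual inverses. A unit outside \<open>D\<close> can only be dominated by its inverse; hence \<open>D\<close> dominates
  iff it meets every one of these sets (\<open>dominating_set_unity_product_graph_iff\<close>). As they are
  pairwise disjoint, a set meeting all of them has at least as many elements as there are sets
  (\<open>card_le_card_hitting_set\<close>), and choosing one element from each attains this bound
  (\<open>disjoint_system_of_representatives\<close>).\<close>

lemma inj_on_choice_disjoint:
  assumes "disjoint P" and f: "\<And>S. S \<in> P \<Longrightarrow> f S \<in> S"
  shows "inj_on f P"
proof (rule inj_onI)
  fix S T assume ST: "S \<in> P" "T \<in> P" "f S = f T"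
  have "f S \<in> S \<inter> T"
    using f[OF ST(1)] f[OF ST(2)] unfolding ST(3) by blast
  then show "S = T"
    using disjointD[OF \<open>disjoint P\<close> ST(1,2)] by blast
qed

lemma card_le_card_hitting_set:
  assumes "disjoint P" "finite D" and meets: "\<And>S. S \<in> P \<Longrightarrow> S \<inter> D \<noteq> {}"
  shows "card P \<le> card D"
proof -
  have "\<forall>S\<in>P. \<exists>x. x \<in> S \<inter> D"
    using meets by blast
  then obtain f where f: "\<And>S. S \<in> P \<Longrightarrow> f S \<in> S \<inter> D"
    by metis
  have "inj_on f P"
    using \<open>disjoint P\<close> f by (intro inj_on_choice_disjoint) blast+
  then show ?thesis
    using f \<open>finite D\<close> by (intro card_inj_on_le[of f]) auto
qed

lemma disjoint_system_of_representatives: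
  assumes "disjoint P" "finite P" "{} \<notin> P"
  obtains D where "D \<subseteq> \<Union> P" "finite D" "card D = card P" "\<And>S. S \<in> P \<Longrightarrow> S \<inter> D \<noteq> {}"
proof -
  have "\<forall>S\<in>P. \<exists>x. x \<in> S"
    using \<open>{} \<notin> P\<close> by (intro ballI) (rule ccontr, simp)
  then obtain f where f: "\<And>S. S \<in> P \<Longrightarrow> f S \<in> S"
    by metis
  have "inj_on f P"
    using \<open>disjoint P\<close> f by (rule inj_on_choice_disjoint)
  show thesis
  proof (rule that[of "f ` P"])
    show "card (f ` P) = card P"
      by (rule card_image) fact
  qed (use f \<open>finite P\<close> in auto)
qed

lemma dominates_unity_product_graph_iff:
  "dominates (with_proj (unity_product_graph R)) r s \<longleftrightarrow>
     r \<in> Units R \<and> s \<in> Units R \<and> r \<noteq> s \<and> r \<otimes>\<^bsub>R\<^esub> s = \<one>\<^bsub>R\<^esub>"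
  by (simp add: arcs_ends_def arc_to_ends_def unity_product_graph_def)

text \<open>Uniqueness of inverses enters in the forward direction: the vertex of \<open>D\<close> that dominates
  \<open>r\<close> is an inverse of \<open>r\<close>, and so it is the other element of the set \<open>{r, s}\<close>.\<close>

lemma dominating_set_unity_product_graph_iff:
  assumes "cring R"
  shows "dominating_set (with_proj (unity_product_graph R)) D \<longleftrightarrow>
    D \<subseteq> Units R \<and> (\<forall>S \<in> mutual_inverse_sets R. S \<inter> D \<noteq> {})"
    (is "?dom \<longleftrightarrow> ?sub \<and> ?meets")
proof -
  interpret cring R by fact
  have verts: "verts (with_proj (unity_product_graph R)) = Units R"
    by (simp add: unity_product_graph_def)
  show ?thesis
  proof (intro iffI conjI ballI)
    assume ?dom
    then show ?sub
      unfolding dominating_set_def verts by (rule conjunct1)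
    fix S assume "S \<in> mutual_inverse_sets R"
    then obtain r s where rs: "S = {r, s}" "r \<in> Units R" "s \<in> Units R" "r \<otimes>\<^bsub>R\<^esub> s = \<one>\<^bsub>R\<^esub>"
      unfolding mutual_inverse_sets_def by blast
    show "S \<inter> D \<noteq> {}"
    proof (cases "r \<in> D")
      case True
      then show ?thesis using rs(1) by blast
    next
      case False
      with \<open>?dom\<close> rs(2) obtain u
        where u: "u \<in> D" "u \<in> Units R" "r \<otimes>\<^bsub>R\<^esub> u = \<one>\<^bsub>R\<^esub>"
        unfolding dominating_set_def verts dominates_unity_product_graph_iff by blast
      have "u = s"
        using comm_inv_char[of r u] comm_inv_char[of r s] rs u by (simp add: Units_closed)
      with u(1) rs(1) show ?thesis by blast
    qed
  next
    assume hit: "?sub \<and> ?meets"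
    have "\<exists>u \<in> D. dominates (with_proj (unity_product_graph R)) v u"
      if v: "v \<in> Units R" "v \<notin> D" for v
    proof -
      have inv: "inv\<^bsub>R\<^esub> v \<in> Units R" "v \<otimes>\<^bsub>R\<^esub> inv\<^bsub>R\<^esub> v = \<one>\<^bsub>R\<^esub>"
        using v(1) by (simp_all)
      then have pair: "{v, inv\<^bsub>R\<^esub> v} \<in> mutual_inverse_sets R"
        using v(1) unfolding mutual_inverse_sets_def by blast
      have "{v, inv\<^bsub>R\<^esub> v} \<inter> D \<noteq> {}"
        using bspec[OF conjunct2[OF hit] pair] .
      with v(2) have "inv\<^bsub>R\<^esub> v \<in> D" by simp
      moreover from this v(2) have "v \<noteq> inv\<^bsub>R\<^esub> v" by metis
      ultimately show ?thesis
        using v(1) inv unfolding dominates_unity_product_graph_iff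
        by (intro bexI[of _ "inv\<^bsub>R\<^esub> v"]) simp_all
    qed
    with hit show ?dom
      unfolding dominating_set_def verts by blast
  qed
qed

theorem theorem5p1:
  fixes R :: "('a, 'b) ring_scheme" and m :: nat
  assumes "cring R"
    and "finite (carrier R)"
    and "card (mutual_inverse_sets R) = m"
  shows "domination_number (with_proj (unity_product_graph R)) = m"
proof -
  let ?P = "mutual_inverse_sets R"
  note dom_iff = dominating_set_unity_product_graph_iff[OF \<open>cring R\<close>]
  note union = mutual_inverse_sets_partition(1)[OF \<open>cring R\<close>]
  note disj = mutual_inverse_sets_partition(3)[OF \<open>cring R\<close>]
  have "finite (Units R)"
    using assms(2) by (rule finite_subset[rotated]) (auto simp: Units_def)
  then have "finite ?P"
    by (intro finite_UnionD) (simp only: union)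
  moreover have "{} \<notin> ?P"
    by (auto simp: mutual_inverse_sets_def)
  ultimately obtain D where D: "D \<subseteq> \<Union> ?P" "finite D" "card D = card ?P"
    "\<And>S. S \<in> ?P \<Longrightarrow> S \<inter> D \<noteq> {}"
    using that by (rule disjoint_system_of_representatives[OF disj])
  show ?thesis
    unfolding domination_number_def
  proof (rule Least_equality)
    show "\<exists>D. dominating_set (with_proj (unity_product_graph R)) D \<and> finite D \<and> card D = m"
      using D assms(3) unfolding dom_iff union by (intro exI[of _ D]) simp
  next
    fix k
    assume "\<exists>D. dominating_set (with_proj (unity_product_graph R)) D \<and> finite D \<and> card D = k"
    then obtain E where E: "\<forall>S \<in> ?P. S \<inter> E \<noteq> {}" "finite E" "card E = k"
      unfolding dom_iff by metis
    show "m \<le> k"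
      using card_le_card_hitting_set[OF disj E(2)] E(1,3) assms(3) by simp
  qed
qed

end
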